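(* Let $t\in[0,1)$ and let $\Theta_t(z)=\left(\frac{z-t}{1-tz}\right)^5$. Then $W(M_{\Theta_t})$ contains a pseudohyperbolic disk of radius $\frac{\sqrt3}{2}$; that is, there is a $z_0\in\mathbb{D}$ with $D_\rho\left(z_0,\tfrac{\sqrt3}{2}\right)\subseteq W(M_{\Theta_t})$.
   Context: $\mathbb{D}$ is the open unit disk in $\mathbb{C}$. For an $n\times n$ complex matrix $A$, the numerical range is $W(A)=\{\langle Ax,x\rangle : x\in\mathbb{C}^n,\ \|x\|=1\}$. For $z_0\in\mathbb{D}$ and $r\in(0,1)$, the pseudohyperbolic disk with center $z_0$ and radius $r$ is $D_\rho(z_0,r)=\{z\in\mathbb{D}: |\frac{z-z_0}{1-\overline{z_0}z}|<r\}$. For $\Theta_t(z)=\left(\frac{z-t}{1-tz}\right)^n$ with $t\in[0,1)$, $M_{\Theta_t}$ is the upper triangular $n\times n$ matrix with diagonal entries $t$, entries $0$ below the diagonal, and entries $(M_{\Theta_t})_{ij}=(1-t^2)(-t)^{j-i-1}$ for $i<j$ (with $(-t)^0=1$). Here $n=5$. *)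

theory Defs
  imports Complex_Main "Jordan_Normal_Form.Matrix" "Jordan_Normal_Form.Conjugate"
begin

definition cvec_norm :: "complex vec \<Rightarrow> real" where
  "cvec_norm x = sqrt (\<Sum>i<dim_vec x. (cmod (x $ i))\<^sup>2)"

text \<open>The form \<open>u \<bullet>c v\<close> is \<open>\<Sum>i. u\<^sub>i * cnj v\<^sub>i\<close>, linear in its first argument.
  The definition is meant for square matrices.\<close>

definition numerical_range :: "complex mat \<Rightarrow> complex set" where
  "numerical_range A =
     {(A *\<^sub>v x) \<bullet>c x | x. x \<in> carrier_vec (dim_row A) \<and> cvec_norm x = 1}"

definition pseudohyperbolic_disk :: "complex \<Rightarrow> real \<Rightarrow> complex set" where
  "pseudohyperbolic_disk z\<^sub>0 r =
     {z. cmod z < 1 \<and> cmod ((z - z\<^sub>0) / (1 - cnj z\<^sub>0 * z)) < r}"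

text \<open>The matrix \<open>M\<^sub>\<Theta>\<close> for the Blaschke product
  \<open>\<Theta>(z) = ((z - t) / (1 - t z))\<^sup>n\<close>.
  Indices run from \<open>0\<close> to \<open>n - 1\<close>; since the entries depend only on the difference
  \<open>j - i\<close>, this agrees with indexing from \<open>1\<close> to \<open>n\<close>.\<close>

definition M_Theta :: "nat \<Rightarrow> real \<Rightarrow> complex mat" where
  "M_Theta n t = mat n n (\<lambda>(i, j).
     if i = j then of_real t
     else if i < j then of_real ((1 - t\<^sup>2) * (- t) ^ (j - i - 1))
     else 0)"

end

theory Submission
  imports "HOL-Analysis.Convex_Euclidean_Space" Defs
begin

text \<open>The disk with \<open>z\<^sub>0 = 5 t / (3 + 2 t\<^sup>2)\<close> works; its derivative at \<open>t = 0\<close> is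
  forced, since there the numerical range is itself the disk of radius \<open>\<surd>3 / 2\<close>. As the numerical
  range is convex and the pseudohyperbolic disk is a Euclidean disk, it suffices to compare support
  functions. In the direction \<open>(cos \<theta>, sin \<theta>)\<close> the largest eigenvalue of the Hermitian part
  is \<open>- T\<^sub>5(y)\<close>, where \<open>2 t cos \<theta> = - (1 + t\<^sup>2) T\<^sub>5(y) - (1 - t\<^sup>2) y U\<^sub>4(y)\<close> and
  \<open>cos(\<pi>/5) \<le> y \<le> 1\<close>. The comparison becomes an inequality affine in \<open>t\<^sup>2\<close>, which has to
  hold where \<open>\<bar>cos \<theta>\<bar> \<le> 1\<close>; that range turns out to be \<open>T\<^sub>3(y)\<^sup>2 \<le> t\<^sup>2 T\<^sub>2(y)\<^sup>2\<close>, and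
  inserting the extreme \<open>t\<^sup>2\<close> leaves a polynomial in \<open>y\<close> alone.\<close>

section \<open>Convexity of numerical ranges and the action of \<open>M_Theta\<close>\<close>

lemma cscalar_prod_self:
  "x \<bullet>c x = complex_of_real ((cvec_norm x)\<^sup>2)" for x :: "complex vec"
proof -
  have "x \<bullet>c x = (\<Sum>i<dim_vec x. complex_of_real ((cmod (x $ i))\<^sup>2))"
    unfolding scalar_prod_def by (simp add: complex_norm_square atLeast0LessThan del: of_real_power)
  then show ?thesis
    by (simp add: cvec_norm_def sum_nonneg)
qed

text \<open>The Rayleigh quotient is invariant under scaling, so points of the numerical range can
  be exhibited by vectors that are not normalised.\<close>

lemma numerical_rangeI:
  assumes A: "A \<in> carrier_mat n n" and x: "x \<in> carrier_vec n" and nz: "x \<bullet>c x \<noteq> 0"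
  shows "(A *\<^sub>v x) \<bullet>c x / (x \<bullet>c x) \<in> numerical_range A"
proof -
  define r where "r = cvec_norm x"
  define y where "y = complex_of_real (1 / r) \<cdot>\<^sub>v x"
  have xx: "x \<bullet>c x = complex_of_real (r\<^sup>2)"
    by (simp add: cscalar_prod_self r_def)
  have y: "y \<in> carrier_vec n"
    using x by (simp add: y_def)
  have r0: "r \<noteq> 0"
    using nz xx by auto
  have conj_y: "conjugate y = complex_of_real (1 / r) \<cdot>\<^sub>v conjugate x"
    unfolding y_def by (rule eq_vecI) auto
  have yy: "y \<bullet>c y = 1"
    unfolding conj_y unfolding y_def using x xx r0 by (simp add: power2_eq_square)
  have "(cvec_norm y)\<^sup>2 = 1"
    using yy unfolding cscalar_prod_self of_real_eq_1_iff .
  moreover have "cvec_norm y \<ge> 0"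
    by (simp add: cvec_norm_def sum_nonneg)
  ultimately have "cvec_norm y = 1"
    by (simp add: power2_eq_1_iff)
  moreover have "(A *\<^sub>v y) \<bullet>c y = (A *\<^sub>v x) \<bullet>c x / (x \<bullet>c x)"
  proof -
    have "A *\<^sub>v y = complex_of_real (1 / r) \<cdot>\<^sub>v (A *\<^sub>v x)"
      unfolding y_def using A x by (simp add: mult_mat_vec)
    then show ?thesis
      unfolding conj_y xx using A x by (simp add: power2_eq_square)
  qed
  ultimately show ?thesis
    unfolding numerical_range_def using A y by force
qed

text \<open>Also applied to the identity matrix, where it expands a squared norm. Having
  \<open>v\<close> as a variable lets the defining equation of a named combination be plugged
  in.\<close>

lemma sesquilinear_expand:
  fixes A :: "complex mat"
  assumes A: "A \<in> carrier_mat n n" and x: "x \<in> carrier_vec n" and y: "y \<in> carrier_vec n"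
    and v: "v = a \<cdot>\<^sub>v x + b \<cdot>\<^sub>v y"
  shows "(A *\<^sub>v v) \<bullet>c v = a * cnj a * ((A *\<^sub>v x) \<bullet>c x) + a * cnj b * ((A *\<^sub>v x) \<bullet>c y)
    + b * cnj a * ((A *\<^sub>v y) \<bullet>c x) + b * cnj b * ((A *\<^sub>v y) \<bullet>c y)"
proof -
  have conj_v: "conjugate v = cnj a \<cdot>\<^sub>v conjugate x + cnj b \<cdot>\<^sub>v conjugate y"
    unfolding v using x y by (intro eq_vecI) auto
  have Av: "A *\<^sub>v v = a \<cdot>\<^sub>v (A *\<^sub>v x) + b \<cdot>\<^sub>v (A *\<^sub>v y)"
    unfolding v using A x y by (simp add: mult_add_distrib_mat_vec[OF A] mult_mat_vec[OF A])
  have c: "A *\<^sub>v x \<in> carrier_vec n" "A *\<^sub>v y \<in> carrier_vec n"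
    "conjugate x \<in> carrier_vec n" "conjugate y \<in> carrier_vec n"
    using A x y by auto
  show ?thesis
    unfolding conj_v Av using c
    by (simp add: add_scalar_prod_distrib[of _ n] scalar_prod_add_distrib[of _ n] algebra_simps)
qed

lemma exists_unimodular_rotation:
  "\<exists>\<eta>. cmod \<eta> = 1 \<and> \<eta> * z = complex_of_real (cmod z)"
proof (cases "z = 0")
  case True
  then show ?thesis by (intro exI[of _ 1]) auto
next
  case False
  then have "cnj z / complex_of_real (cmod z) * z = complex_of_real (cmod z)"
    using complex_norm_square[of z] by (simp add: divide_simps power2_eq_square mult.commute)
  with False show ?thesis
    by (intro exI[of _ "cnj z / complex_of_real (cmod z)"]) (simp add: norm_divide)
qed

text \<open>Toeplitz--Hausdorff: after an affine normalisation sending the two given values to \<open>0\<close> and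
  \<open>1\<close>, a phase \<open>\<eta>\<close> can be chosen so that the form is real along the segment
  from \<open>x\<close> to \<open>\<eta> y\<close>, where the intermediate value theorem applies.\<close>
lemma convex_numerical_range:
  assumes A: "A \<in> carrier_mat n n"
  shows "convex (numerical_range A)"
proof (rule convexI)
  fix p q :: complex and \<sigma> \<tau> :: real
  assume p: "p \<in> numerical_range A" and q: "q \<in> numerical_range A"
    and \<sigma>: "0 \<le> \<sigma>" and \<tau>: "0 \<le> \<tau>" and \<sigma>\<tau>: "\<sigma> + \<tau> = 1"
  show "\<sigma> *\<^sub>R p + \<tau> *\<^sub>R q \<in> numerical_range A"
  proof (cases "p = q")
    case True
    then show ?thesis
      using p \<sigma>\<tau> by (metis scaleR_left_distrib scaleR_one)
  next
    case False
    obtain x where x: "x \<in> carrier_vec n" "cvec_norm x = 1" and px: "p = (A *\<^sub>v x) \<bullet>c x"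
      using p A unfolding numerical_range_def by auto
    obtain y where y: "y \<in> carrier_vec n" "cvec_norm y = 1" and qy: "q = (A *\<^sub>v y) \<bullet>c y"
      using q A unfolding numerical_range_def by auto
    define g where "g = x \<bullet>c y"
    have yx: "y \<bullet>c x = cnj g"
      using x y by (simp add: g_def scalar_prod_def mult.commute)
    \<comment> \<open>\<open>c\<close> and \<open>d\<close> are the mixed values of the form of
      \<open>(A - p) / (q - p)\<close>, which is 0 at \<open>x\<close> and 1 at
      \<open>y\<close>.\<close>
    define c where "c = ((A *\<^sub>v x) \<bullet>c y - p * g) / (q - p)"
    define d where "d = ((A *\<^sub>v y) \<bullet>c x - p * cnj g) / (q - p)"
    \<comment> \<open>Since \<open>cnj \<eta> * c\<close> and \<open>\<eta> * cnj c\<close> have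
      opposite imaginary parts, this choice makes the mixed term
      \<open>cnj \<eta> * c + \<eta> * d\<close> real.\<close>
    obtain \<eta> where \<eta>: "cmod \<eta> = 1" "\<eta> * (d - cnj c) = complex_of_real (cmod (d - cnj c))"
      using exists_unimodular_rotation by blast
    have \<eta>\<eta>: "\<eta> * cnj \<eta> = 1"
      using \<eta>(1) by (simp flip: complex_norm_square)
    define r where "r = Re (cnj \<eta> * c + \<eta> * d)"
    have "Im (\<eta> * (d - cnj c)) = 0"
      using \<eta>(2) by simp
    then have "Im (cnj \<eta> * c + \<eta> * d) = 0"
      by (simp add: algebra_simps)
    then have r: "cnj \<eta> * c + \<eta> * d = complex_of_real r"
      by (simp add: r_def complex_eq_iff)
    define m where "m = 2 * Re (cnj \<eta> * g)"
    have m: "cnj \<eta> * g + \<eta> * cnj g = complex_of_real m"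
      by (simp add: m_def complex_eq_iff)
    define N where "N s = (1 - s)\<^sup>2 + s\<^sup>2 + (1 - s) * s * m" for s :: real
    define v where "v s = complex_of_real (1 - s) \<cdot>\<^sub>v x + (complex_of_real s * \<eta>) \<cdot>\<^sub>v y" for s :: real
    have v: "v s \<in> carrier_vec n" for s
      using x y by (simp add: v_def)
    have vv: "v s \<bullet>c v s = complex_of_real (N s)" for s
    proof -
      have "v s \<bullet>c v s = (1 - s)\<^sup>2 + s\<^sup>2 * (\<eta> * cnj \<eta>) + (1 - s) * s * (cnj \<eta> * g + \<eta> * cnj g)"
        using sesquilinear_expand[of "1\<^sub>m n" n x y, OF _ _ _ v_def[of s]]
          x y v[of s] yx
        by (simp add: g_def[symmetric] one_mult_mat_vec[OF v] cscalar_prod_self[of x] cscalar_prod_self[of y])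
          (simp add: power2_eq_square algebra_simps)
      then show ?thesis
        by (simp add: m \<eta>\<eta> N_def)
    qed
    have Avv: "(A *\<^sub>v v s) \<bullet>c v s = p * N s + (q - p) * complex_of_real (s\<^sup>2 + (1 - s) * s * r)" for s
    proof -
      have c': "(A *\<^sub>v x) \<bullet>c y = (q - p) * c + p * g"
        and d': "(A *\<^sub>v y) \<bullet>c x = (q - p) * d + p * cnj g"
        using False by (simp_all add: c_def d_def)
      have "(A *\<^sub>v v s) \<bullet>c v s = (1 - s)\<^sup>2 * p + s\<^sup>2 * (\<eta> * cnj \<eta>) * q
          + (1 - s) * s * ((q - p) * (cnj \<eta> * c + \<eta> * d) + p * (cnj \<eta> * g + \<eta> * cnj g))"
        using sesquilinear_expand[OF A x(1) y(1) v_def[of s]]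
        by (simp add: px[symmetric] qy[symmetric] c' d')
          (simp add: power2_eq_square algebra_simps)
      also have "\<dots> = p * N s + (q - p) * complex_of_real (s\<^sup>2 + (1 - s) * s * r)"
        unfolding r m \<eta>\<eta> N_def by (simp add: algebra_simps)
      finally show ?thesis .
    qed
    \<comment> \<open>A zero of \<open>f\<close> is a point where the normalised form, divided by
      the squared norm \<open>N s\<close>, equals \<tau>.\<close>
    define f where "f s = s\<^sup>2 + (1 - s) * s * r - \<tau> * N s" for s
    have "\<exists>s\<ge>0. s \<le> 1 \<and> f s = 0"
    proof (rule IVT')
      show "f 0 \<le> 0" using \<tau> by (simp add: f_def N_def)
      show "0 \<le> f 1" using \<sigma> \<sigma>\<tau> by (simp add: f_def N_def)
      show "continuous_on {0..1} f"
        unfolding f_def N_def by (intro continuous_intros)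
    qed simp
    then obtain s where s: "0 \<le> s" "s \<le> 1" "f s = 0"
      by blast
    \<comment> \<open>If \<open>v s\<close> vanished, \<open>x\<close> and \<open>y\<close> would be
      parallel: equal norms force \<open>s = 1 / 2\<close>, and then the form agrees at both, so
      \<open>p = q\<close>.\<close>
    have nz: "v s \<bullet>c v s \<noteq> 0"
    proof
      assume "v s \<bullet>c v s = 0"
      then have vs: "v s = 0\<^sub>v n"
        using conjugate_square_eq_0_vec[OF v] by simp
      have eq: "complex_of_real (1 - s) \<cdot>\<^sub>v x = (- (complex_of_real s * \<eta>)) \<cdot>\<^sub>v y"
      proof (rule eq_vecI)
        fix i assume "i < dim_vec ((- (complex_of_real s * \<eta>)) \<cdot>\<^sub>v y)"
        then have i: "i < n" using y by simp
        have "v s $ i = 0" using vs i by simp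
        then show "(complex_of_real (1 - s) \<cdot>\<^sub>v x) $ i = ((- (complex_of_real s * \<eta>)) \<cdot>\<^sub>v y) $ i"
          using i x y by (simp add: v_def eq_neg_iff_add_eq_0)
      qed (use x y in simp)
      have form: "complex_of_real ((1 - s)\<^sup>2) * ((B *\<^sub>v x) \<bullet>c x) = complex_of_real (s\<^sup>2) * ((B *\<^sub>v y) \<bullet>c y)"
        if B: "B \<in> carrier_mat n n" for B
      proof -
        have "(B *\<^sub>v (\<alpha> \<cdot>\<^sub>v z)) \<bullet>c (\<alpha> \<cdot>\<^sub>v z) = \<alpha> * cnj \<alpha> * ((B *\<^sub>v z) \<bullet>c z)" if z: "z \<in> carrier_vec n"
          for \<alpha> z
        proof -
          have *: "\<alpha> \<cdot>\<^sub>v z = \<alpha> \<cdot>\<^sub>v z + 0 \<cdot>\<^sub>v z"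
            using z by (intro eq_vecI) auto
          then show ?thesis
            using sesquilinear_expand[OF B z z *] by simp
        qed
        from this[OF x(1), of "complex_of_real (1 - s)"] this[OF y(1), of "- (complex_of_real s * \<eta>)"]
        have "complex_of_real ((1 - s)\<^sup>2) * ((B *\<^sub>v x) \<bullet>c x)
          = complex_of_real (s\<^sup>2) * (\<eta> * cnj \<eta>) * ((B *\<^sub>v y) \<bullet>c y)"
          unfolding eq by (simp add: power2_eq_square mult_ac)
        then show ?thesis by (simp add: \<eta>\<eta>)
      qed
      have "complex_of_real ((1 - s)\<^sup>2) = complex_of_real (s\<^sup>2)"
        using form[of "1\<^sub>m n"] x y by (simp add: cscalar_prod_self)
      then have "(1 - s)\<^sup>2 = s\<^sup>2"
        unfolding of_real_eq_iff .
      then have "s = 1 / 2"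
        by (simp add: power2_eq_square algebra_simps)
      with form[OF A] False show False
        by (simp add: px qy power2_eq_square)
    qed
    have "s\<^sup>2 + (1 - s) * s * r = \<tau> * N s"
      using s(3) by (simp add: f_def)
    then have "(A *\<^sub>v v s) \<bullet>c v s = (p + \<tau> * (q - p)) * (v s \<bullet>c v s)"
      unfolding Avv vv by (simp add: algebra_simps)
    then have "(A *\<^sub>v v s) \<bullet>c v s / (v s \<bullet>c v s) = p + \<tau> * (q - p)"
      using nz by simp
    also have "\<dots> = \<sigma> *\<^sub>R p + \<tau> *\<^sub>R q"
    proof -
      have \<sigma>_eq: "\<sigma> = 1 - \<tau>" using \<sigma>\<tau> by simp
      show ?thesis unfolding \<sigma>_eq by (simp add: scaleR_conv_of_real algebra_simps)
    qed
    finally show ?thesis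
      using numerical_rangeI[OF A v nz] by simp
  qed
qed

text \<open>\<open>M\<^sub>\<Theta> = (t + J)(1 + t J)\<^sup>-\<^sup>1\<close> for the nilpotent shift \<open>J\<close>, so
  vectors are best written as \<open>(1 + t J) z\<close>.\<close>
lemma M_Theta_mult_shift:
  assumes "z n = 0"
  shows "M_Theta n t *\<^sub>v vec n (\<lambda>i. z i + of_real t * z (Suc i))
    = vec n (\<lambda>i. of_real t * z i + z (Suc i))"
proof (rule eq_vecI)
  fix i assume "i < dim_vec (vec n (\<lambda>i. of_real t * z i + z (Suc i)))"
  then have i: "i < n" by simp
  define w where "w j = z j + of_real t * z (Suc j)" for j
  \<comment> \<open>Each summand is a difference of consecutive terms
    \<open>(-t)^(j-i-1) * z j\<close>. The end term at \<open>k = n\<close> vanishes because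
    \<open>z n = 0\<close>.\<close>
  have tele: "(\<Sum>j=Suc i..<k. (- of_real t) ^ (j - i - 1) * w j)
      = z (Suc i) - (- of_real t) ^ (k - i - 1) * z k" if "Suc i \<le> k" for k
    using that
  proof (induction k rule: dec_induct)
    case (step k)
    have "k - i = Suc (k - i - 1)" using step by simp
    then have "(- complex_of_real t) ^ (k - i) = - of_real t * (- of_real t) ^ (k - i - 1)"
      by (metis power_Suc)
    with step show ?case
      by (simp add: w_def algebra_simps)
  qed simp
  have "(M_Theta n t *\<^sub>v vec n w) $ i
      = (\<Sum>j=0..<n. (if i = j then of_real t else if i < j
          then of_real ((1 - t\<^sup>2) * (- t) ^ (j - i - 1)) else 0) * w j)"
    using i by (simp add: M_Theta_def scalar_prod_def)
  also have "\<dots> = (\<Sum>j=i..<n. (if i = j then of_real t else if i < j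
          then of_real ((1 - t\<^sup>2) * (- t) ^ (j - i - 1)) else 0) * w j)"
    by (rule sum.mono_neutral_right) auto
  also have "\<dots> = of_real t * w i
      + (\<Sum>j=Suc i..<n. of_real (1 - t\<^sup>2) * ((- of_real t) ^ (j - i - 1) * w j))"
    using i by (simp add: sum.atLeast_Suc_lessThan mult.assoc)
  also have "\<dots> = of_real t * w i + of_real (1 - t\<^sup>2) * z (Suc i)"
    using tele[of n] i assms by (simp add: sum_distrib_left[symmetric])
  also have "\<dots> = of_real t * z i + z (Suc i)"
    by (simp add: w_def power2_eq_square algebra_simps)
  finally show "(M_Theta n t *\<^sub>v vec n (\<lambda>i. z i + of_real t * z (Suc i))) $ i
      = vec n (\<lambda>i. of_real t * z i + z (Suc i)) $ i"
    using i by (simp add: w_def[abs_def])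
qed (simp add: M_Theta_def)

section \<open>Chebyshev polynomials: the inequality in y and the eigenvector\<close>

definition cheb_T5 :: "real \<Rightarrow> real" where
  "cheb_T5 y = 16 * y^5 - 20 * y^3 + 5 * y"

definition cheb_U4 :: "real \<Rightarrow> real" where
  "cheb_U4 y = 16 * y^4 - 12 * y\<^sup>2 + 1"

text \<open>For y = cos phi the polynomials are cos(5 phi) and sin(5 phi) / sin(phi), so this is the
  Pythagorean identity, arranged as it appears in the computation of the squared modulus of
  \<alpha>.\<close>

lemma cheb_pell: "y\<^sup>2 * (cheb_U4 y)\<^sup>2 + 1 - (cheb_T5 y)\<^sup>2 = (cheb_U4 y)\<^sup>2"
  unfolding cheb_T5_def cheb_U4_def by (simp add: eval_nat_numeral algebra_simps)

text \<open>The bound is cos(pi/5), the larger root of this quadratic, which is a factor of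
  \<open>cheb_U4\<close>.\<close>

lemma ge_cos36_imp:
  assumes "(1 + sqrt 5) / 4 \<le> y"
  shows "0 \<le> 4 * y\<^sup>2 - 2 * y - 1"
proof -
  have "4 * y\<^sup>2 - 2 * y - 1 = 4 * (y - (1 + sqrt 5) / 4) * (y - (1 - sqrt 5) / 4)"
    by (simp add: field_simps power2_eq_square)
  moreover have "(1 - sqrt 5) / 4 \<le> y"
    using assms by (smt (verit) real_sqrt_ge_zero divide_right_mono)
  ultimately show ?thesis
    using assms by simp
qed

lemma cheb_U4_nonneg:
  assumes "(1 + sqrt 5) / 4 \<le> y"
  shows "0 \<le> cheb_U4 y"
proof -
  have "cheb_U4 y = (4 * y\<^sup>2 - 2 * y - 1) * (4 * y\<^sup>2 - 2 * y - 1 + 4 * y)"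
    unfolding cheb_U4_def by (simp add: eval_nat_numeral algebra_simps)
  moreover have "0 \<le> y"
    using assms by (smt (verit) real_sqrt_ge_zero divide_nonneg_nonneg)
  ultimately show ?thesis
    using ge_cos36_imp[OF assms] by simp
qed

text \<open>The inequality left after inserting the extreme value of t^2. The number 14/15 lies just
  below 2 cos(pi/5) / sqrt 3, and the expansion about it has only positive coefficients; 15^9 clears
  the denominators in degree 9.\<close>

lemma reduced_polynomial_pos:
  fixes m :: real
  assumes "14 / 15 \<le> m"
  shows "0 < 6 * (72 * m^5 - 105 * m^3 + 30 * m + 8) * m\<^sup>2 * (m + 1)\<^sup>2
    - (21 * m^3 + 42 * m\<^sup>2 + 23 * m + 4) * (3 * m\<^sup>2 - 2)\<^sup>2"
proof -
  define z where "z = 15 * m - 14"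
  have z: "0 \<le> z"
    using assms by (simp add: z_def)
  have "15^9 * (6 * (72 * m^5 - 105 * m^3 + 30 * m + 8) * m\<^sup>2 * (m + 1)\<^sup>2
      - (21 * m^3 + 42 * m\<^sup>2 + 23 * m + 4) * (3 * m\<^sup>2 - 2)\<^sup>2)
    = 75975948648 + 155757808548 * z + 633934937088 * z^2 + 245491614108 * z^3
      + 38740086918 * z^4 + 3239268327 * z^5 + 156637152 * z^6
      + 4412637 * z^7 + 67392 * z^8 + 432 * z^9"
    unfolding z_def by (simp add: eval_nat_numeral algebra_simps)
  moreover have "0 < \<dots>"
    using z by (intro add_pos_nonneg mult_nonneg_nonneg zero_le_power) simp_all
  ultimately show ?thesis
    by (simp add: zero_less_mult_iff)
qed

text \<open>This is the comparison of support functions after eliminating u through \<open>P\<close>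
  and dividing by 1 - t^2. The bound on u gives the lower bound on t^2 that makes it true.\<close>

lemma chebyshev_inequality:
  assumes y: "(1 + sqrt 5) / 4 \<le> y" and t: "0 \<le> t" "t < 1" and u: "\<bar>u\<bar> \<le> 1"
    and P: "2 * t * u = - (1 + t\<^sup>2) * cheb_T5 y - (1 - t\<^sup>2) * (y * cheb_U4 y)"
  shows "0 \<le> - (57 - 22 * t\<^sup>2) * cheb_T5 y + 5 * (3 + 2 * t\<^sup>2) * (y * cheb_U4 y)
    - 4 * sqrt 3 * (9 - 4 * t\<^sup>2)"
proof -
  define T2 T3 U2 where "T2 = 2 * y\<^sup>2 - 1" and "T3 = 4 * y^3 - 3 * y" and "U2 = 4 * y\<^sup>2 - 1"
  define H where "H = - (57 - 22 * t\<^sup>2) * cheb_T5 y + 5 * (3 + 2 * t\<^sup>2) * (y * cheb_U4 y)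
    - 4 * sqrt 3 * (9 - 4 * t\<^sup>2)"
  have "(2::real) \<le> sqrt 5"
    by (rule real_le_rsqrt) simp
  then have y34: "3 / 4 \<le> y" using y by simp
  have "2 * y \<le> U2"
    using ge_cos36_imp[OF y] by (simp add: U2_def)
  moreover have "2 * y * t < 2 * y * 1"
    using y34 t by (intro mult_strict_left_mono) auto
  moreover have "0 \<le> 2 * y * t"
    using y34 t by simp
  ultimately have U2: "0 < U2 - 2 * y * t" "0 < U2 + 2 * y * t"
    using y34 by linarith+
  \<comment> \<open>For y = cos phi these are addition formulas: T5 + y U4 = 2 T3 U2, y U4 - T5 = 4
    y T2 and T2 U2 - 2 y T3 = 1. The second factors are positive, so the signs pass to the first
    ones.\<close>
  have "2 * t - 2 * t * u = 2 * (T2 * t + T3) * (U2 - 2 * y * t)"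
    and "2 * t + 2 * t * u = 2 * (T2 * t - T3) * (U2 + 2 * y * t)"
    unfolding P T2_def T3_def U2_def cheb_T5_def cheb_U4_def by (simp_all add: eval_nat_numeral algebra_simps)
  moreover have "0 \<le> 2 * t * (1 - u)" "0 \<le> 2 * t * (1 + u)"
    using t(1) u by (auto intro!: mult_nonneg_nonneg)
  then have "0 \<le> 2 * t - 2 * t * u" "0 \<le> 2 * t + 2 * t * u"
    by (simp_all add: algebra_simps)
  ultimately have "0 \<le> T2 * t + T3" "0 \<le> T2 * t - T3"
    using U2 by (auto simp: zero_le_mult_iff)
  then have "\<bar>T3\<bar> \<le> \<bar>T2 * t\<bar>"
    by linarith
  then have T: "T3\<^sup>2 \<le> T2\<^sup>2 * t\<^sup>2"
    unfolding power_mult_distrib[symmetric] by (rule abs_le_square_iff[THEN iffD1])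

  \<comment> \<open>The rescaling makes all coefficients rational and moves the double root \<open>y = \<surd>3 / 2\<close>,
    where the disk and the numerical range touch at \<open>t = 0\<close>, to \<open>m = 1\<close>.\<close>
  define m where "m = 2 * y / sqrt 3"
  define A B C where "A = 21 * m^3 + 42 * m\<^sup>2 + 23 * m + 4"
    and "B = 72 * m^5 - 105 * m^3 + 30 * m + 8" and "C = (3 * m\<^sup>2 - 2)\<^sup>2"
  have ym: "y = sqrt 3 / 2 * m"
    by (simp add: m_def)
  have s3: "sqrt 3 ^ 2 = 3" "sqrt 3 ^ 3 = 3 * sqrt 3" "sqrt 3 ^ 4 = 9" "sqrt 3 ^ 5 = 9 * sqrt 3"
    by (simp_all add: eval_nat_numeral)
  \<comment> \<open>The part without t^2 contains \<open>(m - 1)^2\<close>, and so does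
    \<open>T3^2\<close>; hence the lower bound on t^2 can compensate it even near the double
    root.\<close>
  have H: "H = sqrt 3 * (2 * t\<^sup>2 * B - 9 * (m - 1)\<^sup>2 * A)"
    unfolding H_def cheb_T5_def cheb_U4_def A_def B_def ym power_mult_distrib power_divide s3
    by (simp add: field_simps eval_nat_numeral)
  have T2: "T2\<^sup>2 = C / 4"
    unfolding T2_def C_def ym power_mult_distrib power_divide s3
    by (simp add: field_simps eval_nat_numeral)
  have T3: "T3\<^sup>2 = 27 / 4 * m\<^sup>2 * (m + 1)\<^sup>2 * (m - 1)\<^sup>2"
  proof -
    have "T3 = 3 * sqrt 3 / 2 * (m * (m + 1) * (m - 1))"
      unfolding T3_def ym power_mult_distrib power_divide s3
      by (simp add: field_simps eval_nat_numeral)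
    then show ?thesis
      by (simp only: power_mult_distrib power_divide s3) simp
  qed
  have m: "14 / 15 \<le> m"
  proof (rule power2_le_imp_le)
    have "(2236/1000::real) \<le> sqrt 5"
      by (rule real_le_rsqrt) (simp add: power2_eq_square)
    then have "809 / 1000 \<le> y" using y by simp
    then have "(809 / 1000)\<^sup>2 \<le> y\<^sup>2" by (rule power_mono) simp
    moreover have "m\<^sup>2 = 4 * y\<^sup>2 / 3"
      by (simp add: m_def power_divide power_mult_distrib)
    ultimately show "(14 / 15)\<^sup>2 \<le> m\<^sup>2" by (simp add: power2_eq_square)
  qed (use y34 in \<open>simp add: m_def\<close>)
  have key: "0 < 6 * B * m\<^sup>2 * (m + 1)\<^sup>2 - A * C"
    using reduced_polynomial_pos[OF m] unfolding A_def B_def C_def .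
  have A: "0 \<le> A" and C: "0 \<le> C"
    using m by (simp_all add: A_def C_def)
  have "0 < B * (6 * m\<^sup>2 * (m + 1)\<^sup>2)"
    using key mult_nonneg_nonneg[OF A C] by (simp add: mult_ac)
  then have B: "0 \<le> B"
    by (smt (verit) mult_nonneg_nonneg mult_nonpos_nonneg zero_le_power2)
  have C0: "0 < C"
  proof -
    have "(14 / 15)\<^sup>2 \<le> m\<^sup>2" using m by (rule power_mono) simp
    then have "0 < 3 * m\<^sup>2 - 2" by (simp add: power2_eq_square)
    then show ?thesis by (simp add: C_def)
  qed
  \<comment> \<open>\<open>T\<close> reads \<open>4 * T3^2 \<le> C * t^2\<close>. Multiplying the
    goal by \<open>C\<close> inserts this bound without a division.\<close>
  have "9 / 2 * (m - 1)\<^sup>2 * (A * C) \<le> 9 / 2 * (m - 1)\<^sup>2 * (6 * B * m\<^sup>2 * (m + 1)\<^sup>2)"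
    using key by (intro mult_left_mono) auto
  also have "\<dots> = 4 * (B * T3\<^sup>2)"
    unfolding T3 by simp
  also have "\<dots> \<le> B * C * t\<^sup>2"
    using mult_left_mono[OF T B] unfolding T2 by (simp add: mult_ac)
  finally have "0 \<le> C * (2 * t\<^sup>2 * B - 9 * (m - 1)\<^sup>2 * A)"
    by (simp add: algebra_simps)
  then have "0 \<le> 2 * t\<^sup>2 * B - 9 * (m - 1)\<^sup>2 * A"
    using C0 by (simp add: zero_le_mult_iff)
  then show ?thesis
    unfolding H_def[symmetric] H by simp
qed

text \<open>The vector used is an eigenvector of the Hermitian part of \<open>cnj \<omega> M\<^sub>\<Theta>\<close>: in the coordinates \<open>z\<close> of
  \<open>M_Theta_mult_shift\<close> the eigenvalue equation is tridiagonal, and its solution has the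
  Chebyshev polynomials \<open>U\<^sub>4, \<dots>, U\<^sub>0\<close> as moduli.\<close>
lemma support_value_in_numerical_range:
  assumes us: "u\<^sup>2 + s\<^sup>2 = 1" and U: "cheb_U4 y \<ge> 0" and t: "0 \<le> t" "t < 1"
    and y: "2 * t * u = - (1 + t\<^sup>2) * cheb_T5 y - (1 - t\<^sup>2) * (y * cheb_U4 y)"
  shows "\<exists>w\<in>numerical_range (M_Theta 5 t). Re (cnj (Complex u s) * w) = - cheb_T5 y"
proof -
  define h where "h = - cheb_T5 y"
  define \<omega> where "\<omega> = Complex u s"
  \<comment> \<open>\<alpha> couples neighbouring coordinates of z in the form of the Hermitian part
    minus h. Its modulus turns out to be \<open>N\<close>, and \<eta> absorbs its phase.\<close>
  define \<alpha> where "\<alpha> = cnj \<omega> + of_real (t\<^sup>2) * \<omega> - of_real (2 * t * h)"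
  define N where "N = (1 - t\<^sup>2) * cheb_U4 y"
  have tu: "2 * t * u = (1 + t\<^sup>2) * h - (1 - t\<^sup>2) * (y * cheb_U4 y)"
    unfolding y h_def by (simp add: algebra_simps)
  have N0: "0 \<le> N"
    using U t by (simp add: N_def power_le_one)
  have "(cmod \<alpha>)\<^sup>2 = ((1 + t\<^sup>2) * u - 2 * t * h)\<^sup>2 + (1 - t\<^sup>2)\<^sup>2 * s\<^sup>2"
    unfolding cmod_power2 by (simp add: \<alpha>_def \<omega>_def power2_eq_square algebra_simps)
  also have "\<dots> = (2 * t * u)\<^sup>2 - 2 * h * (2 * t * u) * (1 + t\<^sup>2) + 4 * t\<^sup>2 * h\<^sup>2 + (1 - t\<^sup>2)\<^sup>2"
  proof -
    have s2: "s\<^sup>2 = 1 - u\<^sup>2"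
      using us by simp
    show ?thesis
      unfolding s2 by (simp add: power2_eq_square algebra_simps)
  qed
  also have "\<dots> = (1 - t\<^sup>2)\<^sup>2 * (y\<^sup>2 * (cheb_U4 y)\<^sup>2 + 1 - (cheb_T5 y)\<^sup>2)"
    unfolding tu h_def by (simp add: eval_nat_numeral algebra_simps)
  also have "\<dots> = N\<^sup>2"
    unfolding cheb_pell N_def by (simp add: power_mult_distrib)
  finally have "cmod \<alpha> = N"
    using N0 by (simp add: power2_eq_iff_nonneg)
  then obtain \<eta> where \<eta>: "cmod \<eta> = 1" "\<eta> * \<alpha> = complex_of_real N"
    using exists_unimodular_rotation[of \<alpha>] by auto
  have \<eta>\<eta>: "\<eta> * cnj \<eta> = 1"
    using \<eta>(1) by (simp flip: complex_norm_square)
  \<comment> \<open>The list is U_4, ..., U_0 followed by U_{-1} = 0, which supplies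
    \<open>z 5 = 0\<close>.\<close>
  define c :: "nat \<Rightarrow> real" where "c k = [cheb_U4 y, 8 * y^3 - 4 * y, 4 * y\<^sup>2 - 1, 2 * y, 1, 0] ! k" for k
  define z where "z k = \<eta> ^ k * complex_of_real (c k)" for k
  define x where "x = vec 5 (\<lambda>k. z k + of_real t * z (Suc k))"
  have x: "x \<in> carrier_vec 5"
    by (simp add: x_def)
  have A: "M_Theta 5 t \<in> carrier_mat 5 5"
    by (simp add: M_Theta_def)
  have "z 5 = 0"
    by (simp add: z_def c_def)
  then have Mx: "M_Theta 5 t *\<^sub>v x = vec 5 (\<lambda>k. of_real t * z k + z (Suc k))"
    unfolding x_def by (rule M_Theta_mult_shift)
  have cancel: "\<eta> ^ k * a * (cnj \<eta> ^ k * b) = a * b" for k a b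
    using \<eta>\<eta> by (metis (no_types, lifting) mult.assoc mult.left_commute mult_1 power_mult_distrib power_one)
  have form: "(M_Theta 5 t *\<^sub>v x) \<bullet>c x = (\<Sum>k<5. of_real t * ((c k)\<^sup>2 + (c (Suc k))\<^sup>2)
      + c k * c (Suc k) * (\<eta> + of_real (t\<^sup>2) * cnj \<eta>))"
  proof -
    have "(of_real t * z k + z (Suc k)) * cnj (z k + of_real t * z (Suc k))
      = of_real t * ((c k)\<^sup>2 + (c (Suc k))\<^sup>2) + c k * c (Suc k) * (\<eta> + of_real (t\<^sup>2) * cnj \<eta>)" for k
    proof -
      have "(of_real t * z k + z (Suc k)) * cnj (z k + of_real t * z (Suc k))
        = \<eta> ^ k * (of_real t * c k + \<eta> * c (Suc k)) * (cnj \<eta> ^ k * (c k + of_real t * (cnj \<eta> * c (Suc k))))"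
        by (simp add: z_def algebra_simps)
      also have "\<dots> = of_real t * ((c k)\<^sup>2 + (\<eta> * cnj \<eta>) * (c (Suc k))\<^sup>2)
          + c k * c (Suc k) * (\<eta> + of_real (t\<^sup>2) * cnj \<eta>)"
        unfolding cancel by (simp add: power2_eq_square algebra_simps)
      finally show ?thesis
        by (simp add: \<eta>\<eta>)
    qed
    then show ?thesis
      unfolding Mx by (simp add: scalar_prod_def x_def atLeast0LessThan)
  qed
  define n where "n = (\<Sum>k<5. (c k)\<^sup>2 + t\<^sup>2 * (c (Suc k))\<^sup>2 + 2 * t * c k * c (Suc k) * Re \<eta>)"
  have norm: "x \<bullet>c x = of_real n"
  proof -
    have "(z k + of_real t * z (Suc k)) * cnj (z k + of_real t * z (Suc k))
      = of_real ((c k)\<^sup>2 + t\<^sup>2 * (c (Suc k))\<^sup>2 + 2 * t * c k * c (Suc k) * Re \<eta>)" for k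
    proof -
      have "(z k + of_real t * z (Suc k)) * cnj (z k + of_real t * z (Suc k))
        = \<eta> ^ k * (c k + of_real t * (\<eta> * c (Suc k))) * (cnj \<eta> ^ k * (c k + of_real t * (cnj \<eta> * c (Suc k))))"
        by (simp add: z_def algebra_simps)
      also have "\<dots> = (c k)\<^sup>2 + of_real (t\<^sup>2) * (\<eta> * cnj \<eta>) * (c (Suc k))\<^sup>2
          + of_real t * c k * c (Suc k) * (\<eta> + cnj \<eta>)"
        unfolding cancel by (simp add: power2_eq_square algebra_simps)
      finally show ?thesis
        unfolding \<eta>\<eta> complex_add_cnj by simp
    qed
    then show ?thesis
      by (simp add: n_def scalar_prod_def x_def atLeast0LessThan)
  qed
  have "x $ 4 = \<eta> ^ 4"
    by (simp add: x_def z_def c_def)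
  then have "x $ 4 \<noteq> 0"
    using \<eta>(1) by auto
  then have "x \<noteq> 0\<^sub>v 5"
    by auto
  then have nz: "x \<bullet>c x \<noteq> 0"
    using conjugate_square_eq_0_vec[OF x] by simp
  \<comment> \<open>The term \<open>2 * t * h * Re \<eta>\<close> matches the cross terms of
    \<open>h * n\<close>, so the phase drops out of the comparison below.\<close>
  have cross: "Re (cnj \<omega> * (\<eta> + of_real (t\<^sup>2) * cnj \<eta>)) = N + 2 * t * h * Re \<eta>"
  proof -
    have "Re (cnj \<omega> * (\<eta> + of_real (t\<^sup>2) * cnj \<eta>)) = Re (\<eta> * \<alpha>) + 2 * t * h * Re \<eta>"
      by (simp add: \<alpha>_def algebra_simps)
    then show ?thesis
      by (simp add: \<eta>(2))
  qed
  have "Re (cnj \<omega> * ((M_Theta 5 t *\<^sub>v x) \<bullet>c x))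
    = (\<Sum>k<5. t * u * ((c k)\<^sup>2 + (c (Suc k))\<^sup>2) + c k * c (Suc k) * (N + 2 * t * h * Re \<eta>))"
  proof -
    have "Re (cnj \<omega> * (of_real t * ((c k)\<^sup>2 + (c (Suc k))\<^sup>2)
        + c k * c (Suc k) * (\<eta> + of_real (t\<^sup>2) * cnj \<eta>)))
      = t * u * ((c k)\<^sup>2 + (c (Suc k))\<^sup>2) + c k * c (Suc k) * (N + 2 * t * h * Re \<eta>)" for k
    proof -
      have "cnj \<omega> * (of_real t * ((c k)\<^sup>2 + (c (Suc k))\<^sup>2)
          + c k * c (Suc k) * (\<eta> + of_real (t\<^sup>2) * cnj \<eta>))
        = of_real (t * ((c k)\<^sup>2 + (c (Suc k))\<^sup>2)) * cnj \<omega>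
          + of_real (c k * c (Suc k)) * (cnj \<omega> * (\<eta> + of_real (t\<^sup>2) * cnj \<eta>))"
        by (simp add: algebra_simps)
      moreover have "Re (of_real r * w) = r * Re w" for r w
        by simp
      ultimately show ?thesis
        by (simp only: plus_complex.sel cross) (simp add: \<omega>_def)
    qed
    then show ?thesis
      unfolding form sum_distrib_left Re_sum by simp
  qed
  also have "\<dots> = h * n"
  proof -
    have "(\<Sum>k<5. t * u * ((c k)\<^sup>2 + (c (Suc k))\<^sup>2) - h * ((c k)\<^sup>2 + t\<^sup>2 * (c (Suc k))\<^sup>2)
      + c k * c (Suc k) * N) = 0"
    proof -
      have c: "c 0 = cheb_U4 y" "c (Suc 0) = 8 * y^3 - 4 * y" "c (Suc (Suc 0)) = 4 * y\<^sup>2 - 1"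
        "c (Suc (Suc (Suc 0))) = 2 * y" "c (Suc (Suc (Suc (Suc 0)))) = 1"
        "c (Suc (Suc (Suc (Suc (Suc 0))))) = 0"
        by (simp_all add: c_def)
      define S S' C where "S = (\<Sum>k<5. (c k)\<^sup>2)" and "S' = (\<Sum>k<5. (c (Suc k))\<^sup>2)"
        and "C = (\<Sum>k<5. c k * c (Suc k))"
      have five: "{..<5::nat} = {0, Suc 0, Suc (Suc 0), Suc (Suc (Suc 0)), Suc (Suc (Suc (Suc 0)))}"
        by auto
      have S: "S = S' + (cheb_U4 y)\<^sup>2"
        unfolding S_def S'_def five by (simp add: c)
      \<comment> \<open>This is the recurrence 2 y U_k = U_{k+1} + U_{k-1} multiplied by U_k and
        summed, together with T_5 = U_5 - y U_4.\<close>
      have yS: "y * (S + S') = cheb_T5 y * cheb_U4 y + 2 * C"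
        unfolding S_def S'_def C_def five
        by (simp add: c) (simp add: cheb_T5_def cheb_U4_def eval_nat_numeral algebra_simps)
      have "(\<Sum>k<5. t * u * ((c k)\<^sup>2 + (c (Suc k))\<^sup>2) - h * ((c k)\<^sup>2 + t\<^sup>2 * (c (Suc k))\<^sup>2)
          + c k * c (Suc k) * N) = t * u * (S + S') - h * (S + t\<^sup>2 * S') + C * N"
        unfolding S_def S'_def C_def
        by (simp add: sum.distrib sum_subtractf sum_distrib_left sum_distrib_right distrib_left)
      also have "2 * \<dots> = (2 * t * u) * (S + S') - 2 * h * (S + t\<^sup>2 * S') + 2 * C * N"
        by (simp add: algebra_simps)
      also have "\<dots> = (1 - t\<^sup>2) * (- h * (S - S') - cheb_U4 y * (y * (S + S')) + 2 * C * cheb_U4 y)"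
        unfolding tu N_def by (simp add: algebra_simps)
      also have "\<dots> = 0"
        unfolding yS unfolding S h_def by (simp add: power2_eq_square algebra_simps)
      finally show ?thesis
        by simp
    qed
    then show ?thesis
      by (simp add: n_def sum_subtractf sum.distrib sum_distrib_left algebra_simps)
  qed
  finally have "Re (cnj \<omega> * ((M_Theta 5 t *\<^sub>v x) \<bullet>c x) / of_real n) = h"
    using nz norm by (simp only: Re_divide_of_real) simp
  then show ?thesis
    using numerical_rangeI[OF A x nz] unfolding norm \<omega>_def h_def
    by (intro bexI) (simp_all only: times_divide_eq_right)
qed

section \<open>The Euclidean form of the disk and the comparison of support functions\<close>

text \<open>The general centre a(1 - r^2) / (1 - r^2 a^2) and radius r(1 - a^2) / (1 - r^2 a^2),
  taken at r^2 = 3/4.\<close>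

lemma pseudohyperbolic_disk_euclidean:
  assumes a: "\<bar>a\<bar> < 1" and z: "z \<in> pseudohyperbolic_disk (of_real a) (sqrt 3 / 2)"
  shows "cmod (z - of_real (a / (4 - 3 * a\<^sup>2))) < 2 * sqrt 3 * (1 - a\<^sup>2) / (4 - 3 * a\<^sup>2)"
proof -
  define K where "K = 4 - 3 * a\<^sup>2"
  have a2: "a\<^sup>2 < 1"
    using a by (simp add: abs_square_less_1)
  then have K: "0 < K"
    by (simp add: K_def)
  have z1: "cmod z < 1" and zr: "cmod ((z - of_real a) / (1 - of_real a * z)) < sqrt 3 / 2"
    using z by (simp_all add: pseudohyperbolic_disk_def)
  \<comment> \<open>The denominator must be seen to be nonzero before it is cleared: a quotient by
    zero would be 0 and satisfy the bound.\<close>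
  have "cmod (of_real a * z) < 1"
    using a z1 mult_mono[of "\<bar>a\<bar>" 1 "cmod z" "cmod z"] by (simp add: norm_mult)
  then have "of_real a * z \<noteq> 1"
    by auto
  then have "2 * cmod (z - of_real a) < sqrt 3 * cmod (1 - of_real a * z)"
    using zr by (simp add: norm_divide divide_simps mult_ac)
  then have "(2 * cmod (z - of_real a))\<^sup>2 < (sqrt 3 * cmod (1 - of_real a * z))\<^sup>2"
    by (intro power_strict_mono) auto
  then have "4 * ((Re z - a)\<^sup>2 + (Im z)\<^sup>2) < 3 * ((1 - a * Re z)\<^sup>2 + (a * Im z)\<^sup>2)"
    by (simp add: power_mult_distrib cmod_power2)
  \<comment> \<open>Multiplication by \<open>K\<close> allows completing the square; the constants
    collect to \<open>12 * (1 - a^2)^2\<close>.\<close>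
  then have "K * (4 * ((Re z - a)\<^sup>2 + (Im z)\<^sup>2)) < K * (3 * ((1 - a * Re z)\<^sup>2 + (a * Im z)\<^sup>2))"
    using K by simp
  then have "(K * Re z - a)\<^sup>2 + (K * Im z)\<^sup>2 < 12 * (1 - a\<^sup>2)\<^sup>2"
    unfolding K_def by (simp add: eval_nat_numeral algebra_simps)
  moreover have "(K * Re z - a)\<^sup>2 + (K * Im z)\<^sup>2 = (K * cmod (z - of_real (a / K)))\<^sup>2"
  proof -
    have K_Re: "K * Re z - a = K * (Re z - a / K)"
      using K by (simp add: right_diff_distrib)
    show ?thesis
      unfolding K_Re by (simp add: power_mult_distrib cmod_power2 distrib_left)
  qed
  moreover have "12 * (1 - a\<^sup>2)\<^sup>2 = (2 * sqrt 3 * (1 - a\<^sup>2))\<^sup>2"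
    by (simp add: power_mult_distrib)
  ultimately have "(K * cmod (z - of_real (a / K)))\<^sup>2 < (2 * sqrt 3 * (1 - a\<^sup>2))\<^sup>2"
    by simp
  then have "K * cmod (z - of_real (a / K)) < 2 * sqrt 3 * (1 - a\<^sup>2)"
    by (rule power2_less_imp_less) (use a2 in simp)
  then show ?thesis
    unfolding K_def[symmetric] pos_less_divide_eq[OF K] by (simp only: mult.commute)
qed

text \<open>The left-hand side is the support function of the Euclidean disk in the direction (u,
  s). The witness has support value -T_5(y), for a y found by the intermediate value
  theorem.\<close>

lemma support_function_bound:
  assumes us: "u\<^sup>2 + s\<^sup>2 = 1" and t: "0 \<le> t" "t < 1"
  defines "a \<equiv> 5 * t / (3 + 2 * t\<^sup>2)"
  shows "\<exists>w\<in>numerical_range (M_Theta 5 t).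
    a / (4 - 3 * a\<^sup>2) * u + 2 * sqrt 3 * (1 - a\<^sup>2) / (4 - 3 * a\<^sup>2) \<le> Re (cnj (Complex u s) * w)"
proof -
  have "u\<^sup>2 \<le> 1"
    using us by (smt (verit) zero_le_power2)
  then have u: "\<bar>u\<bar> \<le> 1"
    by (simp add: abs_square_le_1)
  have tu: "- t \<le> t * u" "t * u \<le> t"
    using mult_left_mono[of u 1 t] mult_left_mono[of "- 1" u t] t u by auto
  define P where "P y = - (1 + t\<^sup>2) * cheb_T5 y - (1 - t\<^sup>2) * (y * cheb_U4 y)" for y
  define y0 :: real where "y0 = (1 + sqrt 5) / 4"
  have y0_cheb: "cheb_T5 y0 = - 1" "cheb_U4 y0 = 0"
  proof -
    have "sqrt 5 * (sqrt 5 * z) = 5 * z" for z :: real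
      by (simp flip: mult.assoc)
    then show "cheb_T5 y0 = - 1" "cheb_U4 y0 = 0"
      by (simp_all add: cheb_T5_def cheb_U4_def y0_def eval_nat_numeral field_simps)
  qed
  \<comment> \<open>\<open>P y0 - 2 * t\<close> is (1 - t)^2, and \<open>- 2 * t - P 1\<close> is 2
    (1 - t) (3 + 2 t), so the values at the ends enclose \<open>2 * t * u\<close>.\<close>
  have "\<exists>y\<ge>y0. y \<le> 1 \<and> P y = 2 * t * u"
  proof (rule IVT2')
    have "0 \<le> (1 - t) * (3 + 2 * t)"
      using t by simp
    then show "P 1 \<le> 2 * t * u"
      using tu by (simp add: P_def cheb_T5_def cheb_U4_def power2_eq_square algebra_simps)
    have "0 \<le> (1 - t)\<^sup>2"
      by simp
    then show "2 * t * u \<le> P y0"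
      using tu by (simp add: P_def y0_cheb power2_eq_square algebra_simps)
    have "sqrt 5 \<le> 3"
      by (rule real_le_lsqrt) auto
    then show "y0 \<le> 1"
      by (simp add: y0_def)
    show "continuous_on {y0..1} P"
      unfolding P_def cheb_T5_def cheb_U4_def by (intro continuous_intros)
  qed
  then obtain y where y: "y0 \<le> y" and Py: "2 * t * u = P y"
    by metis
  define h where "h = - cheb_T5 y"
  \<comment> \<open>\<open>D\<close> is the numerator of \<open>4 - 3 * a^2\<close> over
    \<open>(3 + 2 * t^2)^2\<close>; it is positive because t^2 < 1.\<close>
  define D where "D = 36 - 27 * t\<^sup>2 + 16 * t\<^sup>2 * t\<^sup>2"
  have q: "t\<^sup>2 < 1"
    using t by (simp add: abs_square_less_1)
  have D: "0 < D"
    using q by (simp add: D_def add_pos_nonneg)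
  have den: "3 + 2 * t\<^sup>2 \<noteq> 0"
    by (smt (verit) zero_le_power2)
  have a2: "a\<^sup>2 = 25 * t\<^sup>2 / (3 + 2 * t\<^sup>2)\<^sup>2"
    by (simp add: a_def power_divide power_mult_distrib)
  have K: "4 - 3 * a\<^sup>2 = D / (3 + 2 * t\<^sup>2)\<^sup>2"
    and L: "1 - a\<^sup>2 = (1 - t\<^sup>2) * (9 - 4 * t\<^sup>2) / (3 + 2 * t\<^sup>2)\<^sup>2"
  proof -
    have "D = 4 * (3 + 2 * t\<^sup>2)\<^sup>2 - 75 * t\<^sup>2"
      and "(1 - t\<^sup>2) * (9 - 4 * t\<^sup>2) = (3 + 2 * t\<^sup>2)\<^sup>2 - 25 * t\<^sup>2"
      by (simp_all add: D_def power2_eq_square algebra_simps)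
    then show "4 - 3 * a\<^sup>2 = D / (3 + 2 * t\<^sup>2)\<^sup>2"
      and "1 - a\<^sup>2 = (1 - t\<^sup>2) * (9 - 4 * t\<^sup>2) / (3 + 2 * t\<^sup>2)\<^sup>2"
      unfolding a2 using den by (simp_all only: diff_divide_distrib) simp_all
  qed
  have c: "a / (4 - 3 * a\<^sup>2) = 5 * t * (3 + 2 * t\<^sup>2) / D"
    unfolding K unfolding a_def using den D by (simp add: divide_simps power2_eq_square)
  have R: "2 * sqrt 3 * (1 - a\<^sup>2) / (4 - 3 * a\<^sup>2) = 2 * sqrt 3 * (1 - t\<^sup>2) * (9 - 4 * t\<^sup>2) / D"
    unfolding K L using den D by simp
  \<comment> \<open>The factor 1 - t^2 splits off since 2 D - 5 (3 + 2 t^2) (1 + t^2) = (1 - t^2)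
    (57 - 22 t^2).\<close>
  have "0 \<le> (1 - t\<^sup>2) * (- (57 - 22 * t\<^sup>2) * cheb_T5 y + 5 * (3 + 2 * t\<^sup>2) * (y * cheb_U4 y)
    - 4 * sqrt 3 * (9 - 4 * t\<^sup>2))"
    using chebyshev_inequality[OF y[unfolded y0_def] t u Py[unfolded P_def]] q by simp
  also have "\<dots> = 2 * D * h - 5 * (3 + 2 * t\<^sup>2) * (2 * t * u) - 4 * sqrt 3 * (1 - t\<^sup>2) * (9 - 4 * t\<^sup>2)"
    unfolding Py P_def D_def h_def by (simp add: eval_nat_numeral algebra_simps)
  finally have "5 * t * (3 + 2 * t\<^sup>2) * u + 2 * sqrt 3 * (1 - t\<^sup>2) * (9 - 4 * t\<^sup>2) \<le> D * h"
    by (simp add: algebra_simps)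
  then have "a / (4 - 3 * a\<^sup>2) * u + 2 * sqrt 3 * (1 - a\<^sup>2) / (4 - 3 * a\<^sup>2) \<le> h"
    unfolding c R using D by (simp add: divide_simps mult.commute)
  moreover obtain w where "w \<in> numerical_range (M_Theta 5 t)" "Re (cnj (Complex u s) * w) = h"
    using support_value_in_numerical_range[OF us cheb_U4_nonneg[OF y[unfolded y0_def]] t Py[unfolded P_def]]
    unfolding h_def by blast
  ultimately show ?thesis
    by auto
qed

theorem theorem2p1:
  fixes t :: real
  assumes "0 \<le> t" and "t < 1"
  shows "\<exists>z\<^sub>0 :: complex. cmod z\<^sub>0 < 1 \<and>
           pseudohyperbolic_disk z\<^sub>0 (sqrt 3 / 2) \<subseteq> numerical_range (M_Theta 5 t)"
proof -
  define a where "a = 5 * t / (3 + 2 * t\<^sup>2)"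
  define W where "W = numerical_range (M_Theta 5 t)"
  \<comment> \<open>The product expands to 3 + 2 t^2 - 5 t, so its positivity says a < 1.\<close>
  have "0 < (1 - t) * (3 - 2 * t)"
    using assms by simp
  then have "5 * t < 3 + 2 * t\<^sup>2"
    by (simp add: power2_eq_square algebra_simps)
  then have a: "\<bar>a\<bar> < 1"
    using assms by (simp add: a_def divide_simps)
  have convex: "convex W"
    unfolding W_def by (rule convex_numerical_range[of _ 5]) (simp add: M_Theta_def)
  have "w \<in> W" if w: "w \<in> pseudohyperbolic_disk (of_real a) (sqrt 3 / 2)" for w
  proof (rule ccontr)
    assume "w \<notin> W"
    moreover have "W \<noteq> {}"
      using support_function_bound[of 1 0 t] assms unfolding W_def by auto
    \<comment> \<open>The separation is only weak; the strictness needed for the contradiction comes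
      from the open disk.\<close>
    ultimately obtain e b where e: "e \<noteq> 0" and le: "\<And>x. x \<in> W \<Longrightarrow> inner e x \<le> b" and ge: "b \<le> inner e w"
      using separating_hyperplane_sets[OF convex convex_singleton[of w]] by blast
    define u s where "u = Re (sgn e)" and "s = Im (sgn e)"
    have "cmod (sgn e) = 1"
      using e by (simp add: norm_sgn)
    then have us: "u\<^sup>2 + s\<^sup>2 = 1"
      unfolding u_def s_def by (metis cmod_power2 one_power2)
    have dir: "Re (cnj (Complex u s) * x) = inner e x / cmod e" for x
      by (simp add: u_def s_def inner_complex_def sgn_div_norm add_divide_distrib divide_inverse algebra_simps)
    define c R where "c = a / (4 - 3 * a\<^sup>2)" and "R = 2 * sqrt 3 * (1 - a\<^sup>2) / (4 - 3 * a\<^sup>2)"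
    obtain x where x: "x \<in> W" "c * u + R \<le> Re (cnj (Complex u s) * x)"
      using support_function_bound[OF us assms] unfolding W_def c_def R_def a_def by blast
    have "Re (cnj (Complex u s) * (w - of_real c)) \<le> cmod (cnj (Complex u s) * (w - of_real c))"
      by (rule complex_Re_le_cmod)
    also have "\<dots> = cmod (w - of_real c)"
    proof -
      have "cmod (Complex u s) = 1"
        using us by (simp add: cmod_def)
      then show ?thesis
        by (simp only: norm_mult complex_mod_cnj mult_1)
    qed
    also have "\<dots> < R"
      unfolding c_def R_def by (rule pseudohyperbolic_disk_euclidean[OF a w])
    finally have "Re (cnj (Complex u s) * w) < c * u + R"
      by (simp add: algebra_simps)
    also note x(2)
    also have "Re (cnj (Complex u s) * x) \<le> Re (cnj (Complex u s) * w)"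
      unfolding dir using le[OF x(1)] ge by (intro divide_right_mono) auto
    finally show False
      by simp
  qed
  then show ?thesis
    using a unfolding W_def by (intro exI[of _ "complex_of_real a"]) auto
qed

end
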